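(* Let $K:(0,\infty)\to\mathbb{R}$ be $C^1$ and strictly decreasing with $\int_0^1 K(r)\,r\,dr<\infty$, and let $D(\Omega)=\int_\Omega\int_\Omega K(|x-y|)\,dx\,dy$. Let $a,b_1,h_1,h_2>0$ and $b_2\ge0$, and let $\Omega\subset\mathbb{R}^2$ be the quadrilateral with (consecutive) vertices $A=(-b_1,h_1)$, $B=(a,0)$, $C=(b_2,-h_2)$, $D=(-a,0)$. For $t\in\mathbb{R}$ let $A_t=(b_1(t-1),h_1)$ and let $\Omega_t$ be the quadrilateral with vertices $A_t,B,C,D$. Then $t\mapsto D(\Omega_t)$ is strictly increasing for $-\infty<t\le1$.
   Context: The quadrilateral $\Omega_t$ is the region enclosed by the closed polygon $A_tBCD$, i.e. (up to a null set) the union of the triangles with vertices $A_t,B,D$ and $C,B,D$; it need not be convex. The letter $D$ alone denotes a vertex, while $D(\cdot)$ denotes the energy functional. The condition $\int_0^1K(r)r\,dr<\infty$ guarantees that $D(\cdot)$ is finite on bounded planar domains. *)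

theory Defs
  imports "HOL-Analysis.Analysis"
begin

text \<open>The plane is \<^typ>\<open>real \<times> real\<close>; its library norm and distance are Euclidean, and
  \<^const>\<open>lborel\<close> on it is two-dimensional Lebesgue measure.\<close>

text \<open>The vertices are listed in cyclic order. The region is the union of the bounded components
  of the complement of the polygon; it is open and need not be convex.\<close>

definition quadrilateral ::
  "real \<times> real \<Rightarrow> real \<times> real \<Rightarrow> real \<times> real \<Rightarrow> real \<times> real \<Rightarrow> (real \<times> real) set" where
  "quadrilateral P Q R S =
     inside (closed_segment P Q \<union> closed_segment Q R \<union> closed_segment R S \<union> closed_segment S P)"

text \<open>A kernel is given on the positive half-line only; the value \<^term>\<open>K 0\<close> of its extension to
  all of \<^typ>\<open>real\<close> enters on the diagonal \<^term>\<open>x = y\<close> alone, hence on a null set.\<close>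

definition energy :: "(real \<Rightarrow> real) \<Rightarrow> (real \<times> real) set \<Rightarrow> real" where
  "energy K \<Omega> = (LINT y:\<Omega>|lborel. LINT x:\<Omega>|lborel. K (norm (x - y)))"

end

(* A quadrilateral with horizontal diagonal is a strip |x - c y| < l y over the heights y, where l
   does not depend on t and c has slope proportional to t - 1 above the diagonal. By Fubini the
   energy is an integral over pairs of heights (y, y') of the interaction of two horizontal segments
   of half-lengths l y, l y'. At a fixed vertical distance d > 0 the kernel u -> K (sqrt (u^2 + d^2))
   is even and strictly decreasing in |u|, and averaging over a symmetric window preserves this. So
   the interaction is a strictly decreasing function of |c y - c y'|, and this distance of the
   midpoints is nonincreasing in t, strictly decreasing when y and y' both lie above the diagonal. *)

theory Submission
  imports Defs
begin

section \<open>Regions bounded by two graphs over the vertical axis\<close>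

text \<open>On a connected set that avoids its zeros the continuous function \<open>g\<close> keeps
  its sign, so a component starting in the strip stays there and is bounded. From a point with
  \<open>g > 0\<close>, a horizontal ray leading away from the midline escapes to infinity without
  meeting the boundary.\<close>

lemma inside_horizontal_strip:
  fixes c l :: "real \<Rightarrow> real"
  assumes cont: "continuous_on UNIV c" "continuous_on UNIV l"
    and bdd: "bounded {p. \<bar>fst p - c (snd p)\<bar> < l (snd p)}"
  shows "inside {p. \<bar>fst p - c (snd p)\<bar> = l (snd p)} = {p. \<bar>fst p - c (snd p)\<bar> < l (snd p)}"
    (is "inside ?S = ?U")
proof -
  define g where "g p = \<bar>fst p - c (snd p)\<bar> - l (snd p)" for p
  have cg: "continuous_on A g" for A
    unfolding g_def
    by (intro continuous_intros continuous_on_compose2[OF cont(1)] continuous_on_compose2[OF cont(2)]) auto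
  have "p \<in> inside ?S" if p: "p \<in> ?U" for p
  proof -
    let ?C = "connected_component_set (- ?S) p"
    have "?C \<subseteq> ?U"
    proof
      fix q assume q: "q \<in> ?C"
      have "p \<in> - ?S"
        using p by simp
      from connected_component_refl[OF this] have "p \<in> ?C"
        by (rule CollectI)
      have con: "connected (g ` ?C)"
        by (intro connected_continuous_image cg connected_connected_component)
      have g: "g p < 0" "g p \<in> g ` ?C" "g q \<in> g ` ?C"
        using p by (simp add: g_def) (intro imageI q \<open>p \<in> ?C\<close>)+
      have "0 \<notin> g ` ?C"
        using connected_component_subset[of "- ?S" p] unfolding g_def image_iff by fastforce
      then have "g q < 0"
        using connectedD_interval[OF con g(2,3), of 0] g(1) by linarith
      then show "q \<in> ?U"
        by (simp add: g_def)
    qed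
    then have "bounded ?C"
      by (rule bounded_subset[OF bdd])
    then show ?thesis
      using p by (simp add: inside_def)
  qed
  moreover have "p \<in> ?U" if p: "p \<in> inside ?S" for p
  proof (rule ccontr)
    assume "p \<notin> ?U"
    moreover have "q \<notin> T \<and> bounded (connected_component_set (- T) q)" if "q \<in> inside T" for q T
      using that by (simp add: inside_def)
    note inside = this[OF p]
    have "p \<notin> ?S"
      by (rule inside[THEN conjunct1])
    ultimately have gp: "\<bar>fst p - c (snd p)\<bar> > l (snd p)"
      by simp
    \<comment> \<open>The ray points away from \<open>c (snd p)\<close>: the height stays fixed
      while the distance from the midline grows, so \<open>R\<close> misses the zero set.\<close>
    define s :: real where "s = (if fst p \<ge> c (snd p) then 1 else -1)"
    define R where "R = (\<lambda>r. p + r *\<^sub>R (s, 0)) ` {0..}"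
    have "connected R"
      unfolding R_def by (intro connected_continuous_image continuous_intros convex_connected convex_real_interval)
    moreover have "R \<subseteq> - ?S"
    proof
      fix q assume "q \<in> R"
      then obtain r where "r \<ge> 0" and q: "q = p + r *\<^sub>R (s, 0)"
        unfolding R_def by blast
      then show "q \<in> - ?S"
        using gp by (cases "fst p \<ge> c (snd p)") (simp_all add: s_def)
    qed
    moreover have "p \<in> R"
      unfolding R_def by (rule image_eqI[of _ _ 0]) (simp_all add: prod_eq_iff)
    ultimately have "R \<subseteq> connected_component_set (- ?S) p"
      by (intro connected_component_maximal) assumption+
    moreover have "bounded (connected_component_set (- ?S) p)"
      by (rule inside[THEN conjunct2])
    ultimately have "bounded R"
      by (rule bounded_subset[rotated])
    then obtain M where M: "\<And>r. r \<ge> 0 \<Longrightarrow> norm (p + r *\<^sub>R (s, 0)) \<le> M"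
      by (auto simp: R_def bounded_iff)
    have "\<bar>r\<bar> \<le> M + norm p" if "r \<ge> 0" for r
    proof -
      have "\<bar>r\<bar> = norm (r *\<^sub>R (s, 0::real))"
        by (simp add: s_def norm_Pair)
      also have "\<dots> = norm ((p + r *\<^sub>R (s, 0)) - p)"
        by simp
      also have "\<dots> \<le> norm (p + r *\<^sub>R (s, 0)) + norm p"
        by (rule norm_triangle_ineq4)
      finally show ?thesis
        using M[OF that] by linarith
    qed
    from this[of "\<bar>M + norm p\<bar> + 1"] show False
      by linarith
  qed
  ultimately show ?thesis
    by blast
qed

text \<open>The convex parameter is the relative height \<open>snd v / h\<close>. Dividing by
  \<open>h\<close> instead of bounding \<open>snd v\<close> makes one description serve for sides
  above and below the diagonal.\<close>

lemma closed_segment_graph: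
  fixes h p q :: real
  assumes "h \<noteq> 0"
  shows "closed_segment (q, 0) (p, h)
    = {v. 0 \<le> snd v / h \<and> snd v / h \<le> 1 \<and> fst v = p * (snd v / h) + q * (1 - snd v / h)}"
    (is "?L = ?R")
proof
  show "?L \<subseteq> ?R"
    using assms by (auto simp: in_segment algebra_simps)
  show "?R \<subseteq> ?L"
  proof
    fix v assume "v \<in> ?R"
    then show "v \<in> ?L"
      using assms by (intro in_segment(1)[THEN iffD2] exI[of _ "snd v / h"])
        (auto simp: prod_eq_iff algebra_simps)
  qed
qed

section \<open>Permuting coordinates in Lebesgue measure\<close>

text \<open>The preimage of a box is a box with the same side lengths in another order, and boxes
  determine Lebesgue measure. The map allows Fubini to integrate over both abscissas with the two
  heights fixed.\<close>

lemma distr_lborel_regroup: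
  "distr lborel lborel (\<lambda>((y, y'), (x, x')). ((x, y), (x', y')))
    = (lborel :: ((real \<times> real) \<times> (real \<times> real)) measure)"
    (is "distr _ _ ?T = _")
proof (rule lborel_eqI[symmetric])
  have T: "?T \<in> borel \<rightarrow>\<^sub>M borel"
    by (intro borel_measurable_continuous_onI) (auto simp: case_prod_unfold intro!: continuous_intros)
  have B: "(Basis :: ((real \<times> real) \<times> (real \<times> real)) set)
      = {((1, 0), (0, 0)), ((0, 1), (0, 0)), ((0, 0), (1, 0)), ((0, 0), (0, 1))}"
    by (simp add: Basis_prod_def zero_prod_def insert_commute)
  fix l u :: "(real \<times> real) \<times> (real \<times> real)"
  assume le: "\<And>b. b \<in> Basis \<Longrightarrow> l \<bullet> b \<le> u \<bullet> b"
  obtain l1 l2 l3 l4 u1 u2 u3 u4 where lu: "l = ((l1, l2), (l3, l4))" "u = ((u1, u2), (u3, u4))"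
    by (metis surj_pair)
  have le': "l1 \<le> u1" "l2 \<le> u2" "l3 \<le> u3" "l4 \<le> u4"
    using le[of "((1, 0), (0, 0))"] le[of "((0, 1), (0, 0))"]
      le[of "((0, 0), (1, 0))"] le[of "((0, 0), (0, 1))"] by (simp_all add: B lu)
  have vi: "?T -` box l u = box ((l2, l4), (l1, l3)) ((u2, u4), (u1, u3))"
    unfolding box_def B lu by auto
  have "emeasure (distr lborel lborel ?T) (box l u) = emeasure lborel (?T -` box l u)"
    using T by (subst emeasure_distr) auto
  also have "\<dots> = (\<Prod>b\<in>Basis. (u - l) \<bullet> b)"
    unfolding vi using le' by (subst emeasure_lborel_box) (auto simp: B lu mult_ac)
  finally show "emeasure (distr lborel lborel ?T) (box l u) = (\<Prod>b\<in>Basis. (u - l) \<bullet> b)" .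
qed auto

section \<open>Even, strictly decreasing profiles and their window integrals\<close>

text \<open>Continuity supplies the antiderivative through which window integrals are
  differentiated; strictness is what the final inequality inherits.\<close>

definition unimodal :: "(real \<Rightarrow> real) \<Rightarrow> bool" where
  "unimodal f \<longleftrightarrow> continuous_on UNIV f \<and> (\<forall>u. f (- u) = f u) \<and> (\<forall>u v. \<bar>u\<bar> < \<bar>v\<bar> \<longrightarrow> f v < f u)"

text \<open>This is the convolution of \<open>f\<close> with the indicator of the open interval from
  \<open>- l\<close> to \<open>l\<close>, not divided by the length of the window.\<close>

definition window :: "real \<Rightarrow> (real \<Rightarrow> real) \<Rightarrow> real \<Rightarrow> real" where
  "window l f v = (LINT u:{u. \<bar>u - v\<bar> < l}|lborel. f u)"

lemma window_interval: "{u. \<bar>u - v\<bar> < l} = {v - l<..<v + l :: real}"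
  by auto

lemma window_primitive:
  assumes F: "\<And>u. (F has_real_derivative f u) (at u)" and "continuous_on UNIV f" "l > 0"
  shows "window l f v = F (v + l) - F (v - l)"
proof -
  \<comment> \<open>Adding the two endpoints, a null set, turns the open window into the closed
    interval of the fundamental theorem of calculus.\<close>
  have "window l f v = (LINT u:{v - l..v + l}|lborel. f u)"
    unfolding window_def window_interval set_lebesgue_integral_def
  proof (rule integral_cong_AE)
    show "AE u in lborel. indicator {v - l<..<v + l} u *\<^sub>R f u = indicator {v - l..v + l} u *\<^sub>R f u"
      using AE_lborel_singleton[of "v - l"] AE_lborel_singleton[of "v + l"]
      by eventually_elim (auto split: split_indicator)
  qed (use borel_measurable_continuous_onI[OF assms(2)] in measurable)
  also have "\<dots> = F (v + l) - F (v - l)"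
    unfolding set_lebesgue_integral_def
    using assms(2,3) F
    by (intro integral_FTC_Icc)
      (auto intro: continuous_on_subset has_field_derivative_at_within
        simp flip: has_real_derivative_iff_has_vector_derivative)
  finally show ?thesis .
qed

text \<open>The derivative at \<open>v\<close> is \<open>f (v + l) - f (v - l)\<close>, negative for
  \<open>v > 0\<close> because \<open>v - l\<close> is then closer to 0 than \<open>v + l\<close>.
  Evenness persists because an antiderivative of an even function is odd up to a constant.\<close>

lemma unimodal_window:
  assumes f: "unimodal f" and l: "l > 0"
  shows "unimodal (window l f)"
proof -
  have cf: "continuous_on UNIV f" and even: "f (- u) = f u" and less: "\<bar>u\<bar> < \<bar>v\<bar> \<Longrightarrow> f v < f u" for u v
    using f by (auto simp: unimodal_def)
  have "isCont f u" for u
    using cf by (simp add: continuous_on_eq_continuous_at)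
  then obtain F where F: "\<And>u. (F has_real_derivative f u) (at u)"
    using einterval_antiderivative[of "-\<infinity>" \<infinity> f]
    by (auto simp: has_real_derivative_iff_has_vector_derivative)
  have W: "window l f v = F (v + l) - F (v - l)" for v
    by (rule window_primitive[OF F cf l])
  have W': "(window l f has_real_derivative f (v + l) - f (v - l)) (at v)" for v
    unfolding W by (auto intro!: derivative_eq_intros DERIV_chain2[OF F])
  have "F u + F (- u) = F 0 + F (- 0)" for u
    by (rule DERIV_isconst_all[where f = "\<lambda>u. F u + F (- u)", rule_format])
      (auto intro!: derivative_eq_intros DERIV_chain2[OF F] simp: even)
  then have odd: "F (- u) = 2 * F 0 - F u" for u
    by (metis add_diff_cancel_left' minus_zero mult_2)
  have ev: "window l f (- v) = window l f v" for v
  proof -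
    have "- v + l = - (v - l)" "- v - l = - (v + l)"
      by simp_all
    then show ?thesis
      by (simp only: W odd)
  qed
  \<comment> \<open>At 0 the derivative vanishes by evenness, so its sign is used only in the open
    interval and continuity takes care of the endpoints.\<close>
  have pos: "window l f w < window l f v" if "0 \<le> v" "v < w" for v w
  proof (rule DERIV_neg_imp_decreasing_open[OF that(2)])
    show "\<exists>y. (window l f has_real_derivative y) (at x) \<and> y < 0" if "v < x" for x
      using W'[of x] less[of "x - l" "x + l"] \<open>0 \<le> v\<close> that l by fastforce
    show "continuous_on {v..w} (window l f)"
      using W' by (meson DERIV_continuous continuous_at_imp_continuous_on)
  qed
  have absev: "window l f \<bar>v\<bar> = window l f v" for v
    using ev[of v] by (auto simp: abs_if)
  show ?thesis
    unfolding unimodal_def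
  proof (intro conjI allI impI ev)
    show "continuous_on UNIV (window l f)"
      using W' by (meson DERIV_continuous continuous_at_imp_continuous_on)
    show "window l f v < window l f u" if "\<bar>u\<bar> < \<bar>v\<bar>" for u v
      using pos[OF _ that] by (simp add: absev)
  qed
qed

lemma unimodal_le:
  assumes "unimodal f" "\<bar>u\<bar> \<le> \<bar>v\<bar>"
  shows "f v \<le> f u"
  using assms by (cases "\<bar>u\<bar> = \<bar>v\<bar>") (auto simp: unimodal_def abs_eq_iff less_imp_le)

text \<open>Substituting \<open>x' = x - u\<close> makes the inner integral a window around
  \<open>x - c'\<close>; shifting \<open>x\<close> by \<open>c'\<close> then centres the outer
  window at \<open>c - c'\<close>. Hence the interaction of two segments sees their midpoints only
  through the difference.\<close>

lemma integral_strips_eq_window: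
  assumes f: "unimodal f"
  shows "(\<integral>x. \<integral>x'. indicator {x. \<bar>x - c\<bar> < l} x * indicator {x'. \<bar>x' - c'\<bar> < l'} x' * f (x - x') \<partial>lborel \<partial>lborel)
    = window l (window l' f) (c - c')"
proof -
  have "(\<integral>x'. indicator {x'. \<bar>x' - c'\<bar> < l'} x' * f (x - x') \<partial>lborel) = window l' f (x - c')" for x
    unfolding window_def set_lebesgue_integral_def
    by (subst lborel_integral_real_affine[of "-1" _ x])
      (auto intro!: Bochner_Integration.integral_cong split: split_indicator)
  then have "(\<integral>x. \<integral>x'. indicator {x. \<bar>x - c\<bar> < l} x * indicator {x'. \<bar>x' - c'\<bar> < l'} x' * f (x - x') \<partial>lborel \<partial>lborel)
    = (\<integral>x. indicator {x. \<bar>x - c\<bar> < l} x * window l' f (x - c') \<partial>lborel)"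
    by (simp add: mult.assoc)
  also have "\<dots> = window l (window l' f) (c - c')"
    unfolding window_def[of l] set_lebesgue_integral_def
    by (subst lborel_integral_real_affine[of 1 _ c'])
      (auto intro!: Bochner_Integration.integral_cong split: split_indicator)
  finally show ?thesis .
qed

section \<open>Finiteness of the energy on bounded planar sets\<close>

text \<open>Continuity is given on the positive half-line only. A norm is positive or 0, so
  \<open>K\<close> may be replaced by a function that is constant \<open>K 0\<close> off the
  half-line.\<close>

lemma norm_kernel_measurable:
  fixes K :: "real \<Rightarrow> real"
  assumes "continuous_on {0<..} K"
  shows "(\<lambda>v :: 'a :: euclidean_space. K (norm v)) \<in> borel_measurable borel"
proof -
  have "(\<lambda>r. if r \<in> {0<..} then K r else K 0) \<in> borel_measurable borel"
    using assms by (intro borel_measurable_continuous_on_if) auto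
  then have "(\<lambda>v :: 'a. if norm v \<in> {0<..} then K (norm v) else K 0) \<in> borel_measurable borel"
    by (rule measurable_compose[OF borel_measurable_norm])
  moreover have "(\<lambda>v :: 'a. if norm v \<in> {0<..} then K (norm v) else K 0) = (\<lambda>v. K (norm v))"
    by auto
  ultimately show ?thesis
    by simp
qed

text \<open>On the disc \<open>K\<close> is dominated by a nonnegative singular part
  \<open>N\<close> living on radii below 1, plus a constant. The plane splits into the cones
  \<open>\<bar>y\<bar> \<le> \<bar>x\<bar>\<close> and
  \<open>\<bar>x\<bar> \<le> \<bar>y\<bar>\<close>, whose sections have length
  \<open>2 * \<bar>x\<bar>\<close> and \<open>2 * \<bar>y\<bar>\<close>; this length produces the
  weight \<open>r\<close> of the hypothesis.\<close>

lemma nn_integral_kernel_disc: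
  fixes K :: "real \<Rightarrow> real"
  assumes cont: "continuous_on {0<..} K" and anti: "antimono_on {0<..} K"
    and int: "set_integrable lborel {0<..<1} (\<lambda>r. K r * r)"
  shows "(\<integral>\<^sup>+v. indicator (cball 0 R) v * ennreal \<bar>K (norm v)\<bar> \<partial>(lborel :: (real \<times> real) measure)) < \<infinity>"
proof -
  \<comment> \<open>Subtracting \<open>K 1\<close> makes the singular part nonnegative and
    decreasing on the positive half-line, and it vanishes from radius 1 on.\<close>
  define N where "N r = (if 0 < r \<and> r < 1 then K r - K 1 else 0)" for r
  have anti': "K s \<le> K r" if "0 < r" "r \<le> s" for r s
    using anti that by (auto simp: monotone_on_def)
  have N0: "N r \<ge> 0" for r
    using anti'[of r 1] by (auto simp: N_def)
  have "(\<lambda>r. if r \<in> {0<..} then K r else 0) \<in> borel_measurable borel"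
    using cont by (intro borel_measurable_continuous_on_if) auto
  then have "(\<lambda>r. if 0 < r \<and> r < 1 then (if r \<in> {0<..} then K r else 0) - K 1 else 0) \<in> borel_measurable borel"
    by measurable
  then have [measurable]: "N \<in> borel_measurable borel"
    by (rule measurable_cong[THEN iffD1, rotated]) (auto simp: N_def)
  have "set_integrable lborel {0<..<1} (\<lambda>r :: real. r)"
    by (rule set_integrable_subset[of _ "{0..1}"]) (auto intro!: borel_integrable_atLeastAtMost')
  then have "integrable lborel (\<lambda>r :: real. indicator {0<..<1} r *\<^sub>R (K r * r) - K 1 * (indicator {0<..<1} r *\<^sub>R r))"
    using int unfolding set_integrable_def
    by (intro Bochner_Integration.integrable_diff integrable_mult_right) auto
  also have "(\<lambda>r :: real. indicator {0<..<1} r *\<^sub>R (K r * r) - K 1 * (indicator {0<..<1} r *\<^sub>R r)) = (\<lambda>r. N r * r)"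
    by (auto simp: fun_eq_iff N_def algebra_simps split: split_indicator)
  finally have "integrable lborel (\<lambda>r. N r * r)" .
  \<comment> \<open>\<open>N r * r\<close> vanishes for \<open>r \<le> 0\<close>, so adding its
    reflection gives the even extension to the whole line.\<close>
  then have "integrable lborel (\<lambda>r. N r * r + N (- r) * (- r))"
    using lborel_integrable_real_affine[of "\<lambda>r. N r * r" "- 1" 0]
    by (intro Bochner_Integration.integrable_add) auto
  also have "(\<lambda>r. N r * r + N (- r) * (- r)) = (\<lambda>r. N \<bar>r\<bar> * \<bar>r\<bar>)"
    by (auto simp: fun_eq_iff N_def)
  finally have fin: "(\<integral>\<^sup>+r. ennreal (N \<bar>r\<bar> * \<bar>r\<bar>) \<partial>lborel) < \<infinity>"
    by (simp add: integrable_iff_bounded abs_mult N0)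
  define f where "f x y = ennreal (N \<bar>x\<bar>) * indicator {- \<bar>x\<bar>..\<bar>x\<bar>} y" for x y :: real
  have f_alt: "f x y = ennreal (N \<bar>x\<bar>) * (if \<bar>y\<bar> \<le> \<bar>x\<bar> then 1 else 0)" for x y
    by (auto simp: f_def split: split_indicator)
  have [measurable]: "(\<lambda>(x, y). f x y) \<in> borel_measurable (lborel \<Otimes>\<^sub>M lborel)"
    "(\<lambda>(x, y). f y x) \<in> borel_measurable (lborel \<Otimes>\<^sub>M lborel)"
    unfolding f_alt by measurable
  have "(\<integral>\<^sup>+y. f x y \<partial>lborel) = 2 * ennreal (N \<bar>x\<bar> * \<bar>x\<bar>)" for x
  proof -
    have "(\<integral>\<^sup>+y. f x y \<partial>lborel) = ennreal (N \<bar>x\<bar>) * ennreal (2 * \<bar>x\<bar>)"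
      unfolding f_def by (subst nn_integral_cmult) auto
    also have "\<dots> = 2 * ennreal (N \<bar>x\<bar> * \<bar>x\<bar>)"
      by (simp add: ennreal_mult N0 mult_ac)
    finally show ?thesis .
  qed
  then have fin_f: "(\<integral>\<^sup>+x. \<integral>\<^sup>+y. f x y \<partial>lborel \<partial>lborel) < \<infinity>"
    using fin by (simp add: nn_integral_cmult ennreal_mult_less_top)
  \<comment> \<open>Replacing the Euclidean norm by the smaller maximum norm avoids polar coordinates.\<close>
  have "ennreal (N (norm (x, y))) \<le> f x y + f y x" for x y :: real
  proof -
    \<comment> \<open>\<open>N\<close> is decreasing only away from 0, where it takes the default
      value 0; the alternative \<open>norm v = 0\<close> covers the origin.\<close>
    have *: "N (norm v) \<le> N r" if "0 < r \<or> norm v = 0" "r \<le> norm v" for r and v :: "real \<times> real"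
      using that anti'[of r "norm v"] N0[of r] by (auto simp: N_def)
    have "\<bar>x\<bar> \<le> norm (x, y)" "\<bar>y\<bar> \<le> norm (x, y)"
      using norm_fst_le[of x y] norm_snd_le[of y x] by auto
    then have "N (norm (x, y)) \<le> (if \<bar>y\<bar> \<le> \<bar>x\<bar> then N \<bar>x\<bar> else N \<bar>y\<bar>)"
      using *[of "\<bar>x\<bar>" "(x, y)"] *[of "\<bar>y\<bar>" "(x, y)"] by (cases "x = 0") (auto simp: norm_Pair)
    then show ?thesis
      by (auto simp: f_alt N0 intro!: add_increasing2 add_increasing ennreal_leI split: if_splits)
  qed
  then have "(\<integral>\<^sup>+v. ennreal (N (norm v)) \<partial>(lborel :: (real \<times> real) measure))
      \<le> (\<integral>\<^sup>+(x, y). f x y + f y x \<partial>(lborel \<Otimes>\<^sub>M lborel))"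
    unfolding lborel_prod by (intro nn_integral_mono) auto
  also have "\<dots> = (\<integral>\<^sup>+(x, y). f x y \<partial>(lborel \<Otimes>\<^sub>M lborel)) + (\<integral>\<^sup>+(x, y). f y x \<partial>(lborel \<Otimes>\<^sub>M lborel))"
    unfolding case_prod_unfold by (intro nn_integral_add) (simp_all add: case_prod_unfold[symmetric])
  also have "(\<integral>\<^sup>+(x, y). f x y \<partial>(lborel \<Otimes>\<^sub>M lborel)) = (\<integral>\<^sup>+x. \<integral>\<^sup>+y. f x y \<partial>lborel \<partial>lborel)"
    by (subst lborel.nn_integral_fst[symmetric]) simp_all
  also have "(\<integral>\<^sup>+(x, y). f y x \<partial>(lborel \<Otimes>\<^sub>M lborel)) = (\<integral>\<^sup>+x. \<integral>\<^sup>+y. f x y \<partial>lborel \<partial>lborel)"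
    by (subst lborel_pair.nn_integral_snd[symmetric]) simp_all
  finally have fin_N: "(\<integral>\<^sup>+v. ennreal (N (norm v)) \<partial>(lborel :: (real \<times> real) measure)) < \<infinity>"
    using fin_f by (auto simp: less_top[symmetric] top_unique)
  \<comment> \<open>\<open>\<bar>K 0\<bar>\<close> covers the centre, \<open>\<bar>K 1\<bar>\<close>
    restores what \<open>N\<close> subtracts, and for radii from 1 to \<open>R\<close> the value of
    \<open>K\<close> lies between \<open>K R\<close> and \<open>K 1\<close>.\<close>
  define M where "M = \<bar>K 0\<bar> + \<bar>K 1\<bar> + \<bar>K R\<bar>"
  have KM: "\<bar>K r\<bar> \<le> N r + M" if "0 \<le> r" "r \<le> R" for r
  proof (cases "r = 0 \<or> r < 1")
    case True
    then show ?thesis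
      using that anti'[of r 1] by (auto simp: N_def M_def)
  next
    case False
    then show ?thesis
      using that anti'[of r R] anti'[of 1 r] by (auto simp: N_def M_def)
  qed
  have "(\<integral>\<^sup>+v. indicator (cball 0 R) v * ennreal \<bar>K (norm v)\<bar> \<partial>(lborel :: (real \<times> real) measure))
      \<le> (\<integral>\<^sup>+v. ennreal (N (norm v)) + ennreal M * indicator (cball 0 R) v \<partial>(lborel :: (real \<times> real) measure))"
    using KM by (intro nn_integral_mono)
      (auto simp: M_def N0 simp flip: ennreal_plus intro!: ennreal_leI split: split_indicator)
  also have "\<dots> = (\<integral>\<^sup>+v. ennreal (N (norm v)) \<partial>(lborel :: (real \<times> real) measure))
      + ennreal M * emeasure lborel (cball (0 :: real \<times> real) R)"
    by (subst nn_integral_add) (auto simp: nn_integral_cmult_indicator intro!: borel_measurable_times_ennreal borel_measurable_indicator)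
  also have "\<dots> < \<infinity>"
    using fin_N emeasure_lborel_cball_finite[of "0 :: real \<times> real" R]
    by (auto simp: ennreal_mult_less_top)
  finally show ?thesis .
qed

text \<open>This is the integrand of \<open>energy\<close> as one function of a pair of points, so
  that Fubini can be applied in any grouping of the coordinates.\<close>

definition interaction :: "(real \<Rightarrow> real) \<Rightarrow> 'a :: real_normed_vector set \<Rightarrow> 'a \<times> 'a \<Rightarrow> real" where
  "interaction K U = (\<lambda>(x, y). indicator U x * indicator U y * K (norm (x - y)))"

text \<open>Differences of points of \<open>U\<close> lie in a fixed disc. By translation invariance
  the inner integral is therefore at most the integral of \<open>\<bar>K (norm v)\<bar>\<close> over
  that disc, uniformly in the outer point, and \<open>U\<close> has finite measure.\<close>

lemma integrable_interaction:
  fixes K :: "real \<Rightarrow> real" and U :: "(real \<times> real) set"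
  assumes cont: "continuous_on {0<..} K" and anti: "antimono_on {0<..} K"
    and int: "set_integrable lborel {0<..<1} (\<lambda>r. K r * r)"
    and U: "bounded U" "U \<in> sets borel"
  shows "integrable lborel (interaction K U)"
proof -
  note [measurable] = U(2)
  have K: "(\<lambda>v :: real \<times> real. K (norm v)) \<in> borel_measurable borel"
    by (rule norm_kernel_measurable[OF cont])
  have "(\<lambda>p :: (real \<times> real) \<times> (real \<times> real). K (norm (fst p - snd p))) \<in> borel_measurable borel"
    by (rule measurable_compose[OF _ K]) (intro borel_measurable_continuous_onI continuous_intros)
  moreover have "(\<lambda>p :: (real \<times> real) \<times> (real \<times> real). indicator U (fst p) :: real) \<in> borel_measurable borel"
    "(\<lambda>p :: (real \<times> real) \<times> (real \<times> real). indicator U (snd p) :: real) \<in> borel_measurable borel"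
    using U(2) by (auto intro: measurable_compose[OF borel_measurable_continuous_onI[OF continuous_on_fst[OF continuous_on_id]]]
        measurable_compose[OF borel_measurable_continuous_onI[OF continuous_on_snd[OF continuous_on_id]]])
  ultimately have meas: "interaction K U \<in> borel_measurable borel"
    unfolding interaction_def case_prod_unfold by (intro borel_measurable_times)
  obtain r where r: "\<And>x. x \<in> U \<Longrightarrow> norm x \<le> r"
    using U(1) by (auto simp: bounded_iff)
  have R: "norm (x - y) \<le> 2 * r" if "x \<in> U" "y \<in> U" for x y
    using norm_triangle_ineq4[of x y] r[OF that(1)] r[OF that(2)] by linarith
  define g where "g v = indicator (cball 0 (2 * r)) v * ennreal \<bar>K (norm v)\<bar>" for v :: "real \<times> real"
  have [measurable]: "g \<in> borel_measurable borel"
    unfolding g_def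
    by (intro borel_measurable_times_ennreal borel_measurable_indicator borel_closed closed_cball
        measurable_compose[OF borel_measurable_abs[OF K] measurable_ennreal])
  have shift: "(\<integral>\<^sup>+y. g (x - y) \<partial>lborel) = (\<integral>\<^sup>+v. g v \<partial>lborel)" for x
  proof -
    have "(\<integral>\<^sup>+v. g v \<partial>lborel) = (\<integral>\<^sup>+v. g v \<partial>distr lborel borel ((+) (- x)))"
      by (simp only: lborel_distr_plus)
    also have "\<dots> = (\<integral>\<^sup>+y. g (- x + y) \<partial>lborel)"
      by (rule nn_integral_distr) simp_all
    also have "\<dots> = (\<integral>\<^sup>+y. g (x - y) \<partial>lborel)"
      by (simp add: g_def norm_minus_commute indicator_def)
    finally show ?thesis ..
  qed
  have "(\<integral>\<^sup>+p. ennreal (norm (interaction K U p)) \<partial>lborel)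
      = (\<integral>\<^sup>+x. \<integral>\<^sup>+y. ennreal (norm (interaction K U (x, y))) \<partial>lborel \<partial>lborel)"
    using lborel.nn_integral_fst[of "\<lambda>p. ennreal (norm (interaction K U p))" lborel] meas
    by (simp add: lborel_prod)
  also have "\<dots> \<le> (\<integral>\<^sup>+x. \<integral>\<^sup>+y. indicator U x * g (x - y) \<partial>lborel \<partial>lborel)"
    using R by (intro nn_integral_mono) (auto simp: interaction_def g_def split: split_indicator)
  also have "\<dots> = (\<integral>\<^sup>+v. g v \<partial>lborel) * emeasure lborel U"
    by (simp add: nn_integral_cmult shift nn_integral_multc mult.commute)
  also have "\<dots> < \<infinity>"
    using nn_integral_kernel_disc[OF cont anti int, of "2 * r"] emeasure_bounded_finite[OF U(1)]
    by (simp add: g_def ennreal_mult_less_top)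
  finally show ?thesis
    using meas by (intro integrableI_bounded) auto
qed

lemma energy_eq_integral:
  assumes "integrable lborel (interaction K U)"
  shows "energy K U = integral\<^sup>L lborel (interaction K U)"
proof -
  have "integral\<^sup>L lborel (interaction K U) = (\<integral>y. \<integral>x. interaction K U (y, x) \<partial>lborel \<partial>lborel)"
    using assms by (simp add: lborel_pair.integral_fst' lborel_prod)
  also have "\<dots> = energy K U"
    unfolding energy_def set_lebesgue_integral_def interaction_def
    by (simp add: mult.assoc norm_minus_commute)
  finally show ?thesis ..
qed

section \<open>The energy as an integral over pairs of heights\<close>

text \<open>Pairs of equal heights have vertical distance 0, which \<open>unimodal_kernel\<close>
  excludes; they form a null set.\<close>

lemma AE_lborel_neq: "AE p in (lborel :: (real \<times> real) measure). fst p \<noteq> snd p"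
proof -
  have "AE p in lborel \<Otimes>\<^sub>M lborel. fst p \<noteq> (snd p :: real)"
  proof (rule lborel_pair.AE_pair_measure)
    have "AE y in lborel. x \<noteq> y" for x :: real
      using AE_lborel_singleton[of x] by eventually_elim simp
    then show "AE x in lborel. AE y in lborel. fst (x, y) \<noteq> (snd (x, y) :: real)"
      by simp
  qed measurable
  then show ?thesis
    unfolding lborel_prod .
qed

text \<open>The interaction of the slices at heights \<open>y\<close> and \<open>y'\<close>, in the
  form provided by \<open>integral_strips_eq_window\<close>.\<close>

definition slice_energy :: "(real \<Rightarrow> real) \<Rightarrow> (real \<Rightarrow> real) \<Rightarrow> (real \<Rightarrow> real) \<Rightarrow> real \<times> real \<Rightarrow> real" where
  "slice_energy K c l = (\<lambda>(y, y'). window (l y) (window (l y') (\<lambda>u. K (sqrt (u\<^sup>2 + (y - y')\<^sup>2)))) (c y - c y'))"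

lemma unimodal_kernel:
  assumes cont: "continuous_on {0<..} K" and anti: "strict_antimono_on {0<..} K" and d: "d \<noteq> 0"
  shows "unimodal (\<lambda>u. K (sqrt (u\<^sup>2 + d\<^sup>2)))"
proof -
  have pos: "u\<^sup>2 + d\<^sup>2 > 0" for u
    using d by (simp add: add_nonneg_pos)
  have "continuous_on UNIV (\<lambda>u. K (sqrt (u\<^sup>2 + d\<^sup>2)))"
    using pos by (intro continuous_on_compose2[OF cont] continuous_intros) auto
  moreover have "K (sqrt (v\<^sup>2 + d\<^sup>2)) < K (sqrt (u\<^sup>2 + d\<^sup>2))" if "\<bar>u\<bar> < \<bar>v\<bar>" for u v
  proof -
    have "u\<^sup>2 < v\<^sup>2"
      using that by (metis abs_ge_zero power2_abs power_strict_mono zero_less_numeral)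
    then show ?thesis
      using anti pos by (auto simp: monotone_on_def)
  qed
  ultimately show ?thesis
    by (simp add: unimodal_def)
qed

text \<open>\<open>H\<close> is the inner Fubini integral over the abscissas after regrouping, so
  its integrability comes for free. It is identified with \<open>slice_energy\<close> where the
  fibre is integrable and the heights differ, hence almost everywhere.\<close>

lemma energy_horizontal_strip:
  fixes K c l :: "real \<Rightarrow> real"
  assumes cont: "continuous_on {0<..} K" and anti: "strict_antimono_on {0<..} K"
    and intg: "integrable lborel (interaction K {p. \<bar>fst p - c (snd p)\<bar> < l (snd p)})"
  obtains H where "integrable lborel H"
    "energy K {p. \<bar>fst p - c (snd p)\<bar> < l (snd p)} = integral\<^sup>L lborel H"
    "AE s in lborel. H s = slice_energy K c l s"
proof -
  let ?U = "{p. \<bar>fst p - c (snd p)\<bar> < l (snd p)}"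
  let ?T = "\<lambda>((y, y'), (x, x')). ((x, y), (x', y')) :: (real \<times> real) \<times> (real \<times> real)"
  define J where "J p = interaction K ?U (?T p)" for p
  have T: "?T \<in> lborel \<rightarrow>\<^sub>M lborel"
    by (simp, intro borel_measurable_continuous_onI) (auto simp: case_prod_unfold intro!: continuous_intros)
  have meas: "interaction K ?U \<in> borel_measurable lborel"
    by (rule borel_measurable_integrable[OF intg])
  have J: "integrable (lborel \<Otimes>\<^sub>M lborel) J"
    using integrable_distr_eq[OF T meas] intg unfolding J_def distr_lborel_regroup lborel_prod by simp
  define H where "H s = (\<integral>p. J (s, p) \<partial>lborel)" for s
  have "integrable lborel H"
    unfolding H_def by (rule lborel_pair.integrable_fst'[OF J])
  moreover have "energy K ?U = integral\<^sup>L lborel H"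
  proof -
    have "energy K ?U = integral\<^sup>L lborel J"
      unfolding energy_eq_integral[OF intg] J_def
      using integral_distr[OF T meas] unfolding distr_lborel_regroup .
    then show ?thesis
      using lborel_pair.integral_fst'[OF J] by (simp add: H_def[abs_def] lborel_prod)
  qed
  moreover have "AE s in lborel. H s = slice_energy K c l s"
    using lborel_pair.AE_integrable_fst'[OF J] AE_lborel_neq
  proof eventually_elim
    case (elim s)
    obtain y y' where s: "s = (y, y')"
      by (cases s)
    have J_eq: "J (s, (x, x')) = indicator {x. \<bar>x - c y\<bar> < l y} x * indicator {x'. \<bar>x' - c y'\<bar> < l y'} x'
        * K (sqrt ((x - x')\<^sup>2 + (y - y')\<^sup>2))" for x x'
      by (simp add: J_def s interaction_def norm_Pair indicator_def)
    have "H s = (\<integral>x. \<integral>x'. J (s, (x, x')) \<partial>lborel \<partial>lborel)"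
      unfolding H_def using lborel_pair.integral_fst'[of "\<lambda>p. J (s, p)"] elim by (simp add: lborel_prod)
    also have "\<dots> = slice_energy K c l s"
      unfolding J_eq
      using integral_strips_eq_window[OF unimodal_kernel[OF cont anti, of "y - y'"]] elim
      by (simp add: slice_energy_def s)
    finally show ?case .
  qed
  ultimately show ?thesis
    by (rule that)
qed

section \<open>Comparing strips with the same widths and different midlines\<close>

lemma window_nonpos: "l \<le> 0 \<Longrightarrow> window l f = (\<lambda>_. 0)"
  by (auto simp: window_def set_lebesgue_integral_def fun_eq_iff)

text \<open>Two successive windows of positive half-length keep the kernel unimodal, so closer
  midpoints interact more. If a half-length is nonpositive, that slice is empty and both sides are
  0.\<close>

lemma slice_energy_mono:
  assumes cont: "continuous_on {0<..} K" and anti: "strict_antimono_on {0<..} K"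
    and y: "y \<noteq> y'" and le: "\<bar>c\<^sub>2 y - c\<^sub>2 y'\<bar> \<le> \<bar>c\<^sub>1 y - c\<^sub>1 y'\<bar>"
  shows "slice_energy K c\<^sub>1 l (y, y') \<le> slice_energy K c\<^sub>2 l (y, y')"
    and "l y > 0 \<Longrightarrow> l y' > 0 \<Longrightarrow> \<bar>c\<^sub>2 y - c\<^sub>2 y'\<bar> < \<bar>c\<^sub>1 y - c\<^sub>1 y'\<bar>
      \<Longrightarrow> slice_energy K c\<^sub>1 l (y, y') < slice_energy K c\<^sub>2 l (y, y')"
proof -
  have uni: "unimodal (window (l y) (window (l y') (\<lambda>u. K (sqrt (u\<^sup>2 + (y - y')\<^sup>2)))))"
    if "l y > 0" "l y' > 0"
    using that y by (intro unimodal_window unimodal_kernel[OF cont anti]) auto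
  show "slice_energy K c\<^sub>1 l (y, y') \<le> slice_energy K c\<^sub>2 l (y, y')"
  proof (cases "l y > 0 \<and> l y' > 0")
    case True
    then show ?thesis
      using unimodal_le[OF uni le] by (simp add: slice_energy_def)
  next
    case False
    \<comment> \<open>Either the outer window is empty, or the inner one is and the outer window
      integrates the zero function.\<close>
    then have "slice_energy K c l (y, y') = 0" for c
      by (auto simp: slice_energy_def window_nonpos not_less) (simp add: window_def)
    then show ?thesis
      by simp
  qed
  show "slice_energy K c\<^sub>1 l (y, y') < slice_energy K c\<^sub>2 l (y, y')"
    if "l y > 0" "l y' > 0" "\<bar>c\<^sub>2 y - c\<^sub>2 y'\<bar> < \<bar>c\<^sub>1 y - c\<^sub>1 y'\<bar>"
    using uni that by (simp add: slice_energy_def unimodal_def)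
qed

text \<open>The weak inequality integrates from the slices. Equality of the integrals would force
  \<open>H\<^sub>1 = H\<^sub>2\<close> almost everywhere, making \<open>G\<close> a null set, which
  a nonempty open set is not.\<close>

lemma energy_horizontal_strip_less:
  fixes K c\<^sub>1 c\<^sub>2 l :: "real \<Rightarrow> real"
  assumes cont: "continuous_on {0<..} K" and anti: "strict_antimono_on {0<..} K"
    and int: "integrable lborel (interaction K {p. \<bar>fst p - c\<^sub>1 (snd p)\<bar> < l (snd p)})"
      "integrable lborel (interaction K {p. \<bar>fst p - c\<^sub>2 (snd p)\<bar> < l (snd p)})"
    and le: "\<And>y y'. \<bar>c\<^sub>2 y - c\<^sub>2 y'\<bar> \<le> \<bar>c\<^sub>1 y - c\<^sub>1 y'\<bar>"
    and G: "open G" "G \<noteq> {}"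
    and less: "\<And>y y'. (y, y') \<in> G \<Longrightarrow> l y > 0 \<and> l y' > 0 \<and> \<bar>c\<^sub>2 y - c\<^sub>2 y'\<bar> < \<bar>c\<^sub>1 y - c\<^sub>1 y'\<bar>"
  shows "energy K {p. \<bar>fst p - c\<^sub>1 (snd p)\<bar> < l (snd p)} < energy K {p. \<bar>fst p - c\<^sub>2 (snd p)\<bar> < l (snd p)}"
proof -
  obtain H\<^sub>1 where H1: "integrable lborel H\<^sub>1"
    "energy K {p. \<bar>fst p - c\<^sub>1 (snd p)\<bar> < l (snd p)} = integral\<^sup>L lborel H\<^sub>1"
    "AE s in lborel. H\<^sub>1 s = slice_energy K c\<^sub>1 l s"
    by (rule energy_horizontal_strip[OF cont anti int(1)])
  obtain H\<^sub>2 where H2: "integrable lborel H\<^sub>2"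
    "energy K {p. \<bar>fst p - c\<^sub>2 (snd p)\<bar> < l (snd p)} = integral\<^sup>L lborel H\<^sub>2"
    "AE s in lborel. H\<^sub>2 s = slice_energy K c\<^sub>2 l s"
    by (rule energy_horizontal_strip[OF cont anti int(2)])
  note mono = slice_energy_mono[OF cont anti]
  have H12: "AE s in lborel. H\<^sub>1 s \<le> H\<^sub>2 s \<and> (s \<in> G \<longrightarrow> H\<^sub>1 s < H\<^sub>2 s)"
    using H1(3) H2(3) AE_lborel_neq
  proof eventually_elim
    case (elim s)
    then show ?case
      using mono[of "fst s" "snd s" c\<^sub>2 c\<^sub>1 l] less[of "fst s" "snd s"] le by simp
  qed
  have "integral\<^sup>L lborel H\<^sub>1 \<noteq> integral\<^sup>L lborel H\<^sub>2"
  proof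
    assume "integral\<^sup>L lborel H\<^sub>1 = integral\<^sup>L lborel H\<^sub>2"
    then have "(\<integral>s. H\<^sub>2 s - H\<^sub>1 s \<partial>lborel) = 0"
      using H1(1) H2(1) by simp
    then have "AE s in lborel. H\<^sub>2 s - H\<^sub>1 s = 0"
      using H1(1) H2(1) H12 by (subst (asm) integral_nonneg_eq_0_iff_AE) (auto elim!: eventually_mono)
    then have "AE s in lborel. s \<notin> G"
      using H12 by eventually_elim auto
    then have "G \<in> null_sets lborel"
      using G(1) by (subst AE_iff_null_sets) auto
    then have "negligible G"
      by (simp add: negligible_iff_null_sets null_sets_completionI)
    then show False
      using open_not_negligible[OF G] by simp
  qed
  moreover have "integral\<^sup>L lborel H\<^sub>1 \<le> integral\<^sup>L lborel H\<^sub>2"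
    using H1(1) H2(1) H12 by (intro integral_mono_AE) auto
  ultimately have "integral\<^sup>L lborel H\<^sub>1 < integral\<^sup>L lborel H\<^sub>2"
    by simp
  then show ?thesis
    by (simp add: H1(2) H2(2))
qed

section \<open>The quadrilateral as a strip around a broken midline\<close>

text \<open>At height \<open>y\<close> the left and right sides lie symmetrically about
  \<open>c y\<close>, which runs along the broken line from \<open>(p, h\<^sub>1)\<close> through
  the origin to \<open>(q, - h\<^sub>2)\<close>. The minimum in \<open>l\<close> selects the linear
  half-length on each side of the diagonal and is negative beyond the outer vertices, which keeps
  the strip bounded. Signs of \<open>p\<close> and \<open>q\<close> are free, so nonconvex shapes
  are covered.\<close>

lemma quadrilateral_eq_strip:
  fixes a p h\<^sub>1 q h\<^sub>2 :: real
  assumes a: "a > 0" and h1: "h\<^sub>1 > 0" and h2: "h\<^sub>2 > 0"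
  defines "c \<equiv> \<lambda>y. if y \<ge> 0 then p / h\<^sub>1 * y else - (q / h\<^sub>2) * y"
    and "l \<equiv> \<lambda>y. a * min (1 - y / h\<^sub>1) (1 + y / h\<^sub>2)"
  shows "quadrilateral (p, h\<^sub>1) (a, 0) (q, - h\<^sub>2) (- a, 0) = {v. \<bar>fst v - c (snd v)\<bar> < l (snd v)}" (is "_ = ?U")
    and "bounded {v. \<bar>fst v - c (snd v)\<bar> < l (snd v)}"
    and "{v. \<bar>fst v - c (snd v)\<bar> < l (snd v)} \<in> sets borel"
proof -
  have c: "continuous_on UNIV c"
  proof -
    have "c = (\<lambda>y. p / h\<^sub>1 * max y 0 - q / h\<^sub>2 * min y 0)"
      by (auto simp: c_def fun_eq_iff)
    then show ?thesis
      using h1 h2 by (auto intro!: continuous_intros)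
  qed
  have l: "continuous_on UNIV l"
    unfolding l_def using h1 h2 by (intro continuous_intros) auto
  have lU: "- h\<^sub>2 < y" "y < h\<^sub>1" "l y \<le> a" if "l y > 0" for y
  proof -
    have "0 < 1 - y / h\<^sub>1 \<and> 0 < 1 + y / h\<^sub>2"
      using that a unfolding l_def by (simp add: zero_less_mult_iff)
    then show "- h\<^sub>2 < y" "y < h\<^sub>1"
      using h1 h2 by (auto simp: field_simps)
    have "min (1 - y / h\<^sub>1) (1 + y / h\<^sub>2) \<le> 1"
      using h1 h2 by (cases "y \<ge> 0") (auto simp: min_le_iff_disj divide_nonpos_pos)
    then show "l y \<le> a"
      using a unfolding l_def by (simp add: mult_le_cancel_left1)
  qed
  have cU: "\<bar>c y\<bar> \<le> \<bar>p\<bar> + \<bar>q\<bar>" if "l y > 0" for y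
  proof -
    have "\<bar>c y\<bar> \<le> max \<bar>p\<bar> \<bar>q\<bar>"
    proof (cases "y \<ge> 0")
      case True
      then have "\<bar>c y\<bar> = \<bar>p\<bar> * (y / h\<^sub>1)" "y / h\<^sub>1 \<le> 1"
        using lU(2)[OF that] h1 by (auto simp: c_def abs_mult abs_divide)
      then show ?thesis
        using mult_left_le[of "y / h\<^sub>1" "\<bar>p\<bar>"] by auto
    next
      case False
      then have "\<bar>c y\<bar> = \<bar>q\<bar> * (- y / h\<^sub>2)" "- y / h\<^sub>2 \<le> 1"
        using lU(1)[OF that] h2 by (simp_all add: c_def abs_mult pos_le_divide_eq)
      then show ?thesis
        using mult_left_le[of "- y / h\<^sub>2" "\<bar>q\<bar>"] by auto
    qed
    then show ?thesis
      by linarith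
  qed
  have "?U \<subseteq> {- (\<bar>p\<bar> + \<bar>q\<bar> + a)..\<bar>p\<bar> + \<bar>q\<bar> + a} \<times> {- h\<^sub>2..h\<^sub>1}"
  proof
    fix v assume v: "v \<in> ?U"
    then have "l (snd v) > 0"
      by auto
    from lU[OF this] cU[OF this] show "v \<in> {- (\<bar>p\<bar> + \<bar>q\<bar> + a)..\<bar>p\<bar> + \<bar>q\<bar> + a} \<times> {- h\<^sub>2..h\<^sub>1}"
      using v by (auto simp: mem_Times_iff)
  qed
  then show bdd: "bounded ?U"
    by (rule bounded_subset[rotated]) (intro bounded_Times bounded_closed_interval)
  show "?U \<in> sets borel"
  proof -
    have "open ?U"
      by (intro open_Collect_less continuous_intros continuous_on_compose2[OF c] continuous_on_compose2[OF l]) auto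
    then show ?thesis
      by simp
  qed
  have l_up: "l y = a * (1 - y / h\<^sub>1)" if "y \<ge> 0" for y
  proof -
    have "y / h\<^sub>1 \<ge> 0" "y / h\<^sub>2 \<ge> 0"
      using that h1 h2 by auto
    then show ?thesis
      by (simp add: l_def min_def)
  qed
  have l_down: "l y = a * (1 + y / h\<^sub>2)" if "y \<le> 0" for y
  proof -
    have "y / h\<^sub>1 \<le> 0" "y / h\<^sub>2 \<le> 0"
      using that h1 h2 by (auto simp: divide_nonpos_pos)
    then show ?thesis
      by (simp add: l_def min_def)
  qed
  have "closed_segment (p, h\<^sub>1) (a, 0) \<union> closed_segment (a, 0) (q, - h\<^sub>2)
      \<union> closed_segment (q, - h\<^sub>2) (- a, 0) \<union> closed_segment (- a, 0) (p, h\<^sub>1)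
      = {v. \<bar>fst v - c (snd v)\<bar> = l (snd v)}" (is "?P = ?S")
  proof -
    have "v \<in> ?P \<longleftrightarrow> v \<in> ?S" for v
    proof -
      obtain x y where v: "v = (x, y)"
        by (cases v)
      have up: "v \<in> closed_segment (r, 0) (p, h\<^sub>1) \<longleftrightarrow> 0 \<le> y \<and> y / h\<^sub>1 \<le> 1 \<and> x = p * (y / h\<^sub>1) + r * (1 - y / h\<^sub>1)" for r
        using h1 by (simp add: v closed_segment_graph zero_le_divide_iff)
      have down: "v \<in> closed_segment (r, 0) (q, - h\<^sub>2) \<longleftrightarrow> y \<le> 0 \<and> - y / h\<^sub>2 \<le> 1 \<and> x = q * (- y / h\<^sub>2) + r * (1 + y / h\<^sub>2)" for r
        using h2 by (simp add: v closed_segment_graph zero_le_divide_iff divide_le_0_iff)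
      \<comment> \<open>The two signs of \<open>z\<close> are the right and left sides;
        \<open>0 \<le> w\<close> confines the height to that of the side.\<close>
      have *: "\<bar>z\<bar> = a * w \<longleftrightarrow> 0 \<le> w \<and> (z = a * w \<or> z = - (a * w))" for z w
      proof -
        have "0 \<le> a * w \<longleftrightarrow> 0 \<le> w"
          using a by (simp add: zero_le_mult_iff)
        then show ?thesis
          by linarith
      qed
      have P: "v \<in> ?P \<longleftrightarrow> v \<in> closed_segment (a, 0) (p, h\<^sub>1) \<or> v \<in> closed_segment (a, 0) (q, - h\<^sub>2)
          \<or> v \<in> closed_segment (- a, 0) (q, - h\<^sub>2) \<or> v \<in> closed_segment (- a, 0) (p, h\<^sub>1)"
        by (simp only: Un_iff disj_assoc closed_segment_commute[of "(p, h\<^sub>1)" "(a, 0)"] closed_segment_commute[of "(q, - h\<^sub>2)"])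
      consider "y > 0" | "y = 0" | "y < 0"
        by linarith
      then show ?thesis
      proof cases
        case 1
        then show ?thesis
          unfolding P up down by (auto simp: v l_up c_def *)
      next
        \<comment> \<open>At height 0 each side contributes only its endpoint \<open>(a, 0)\<close>
          or \<open>(- a, 0)\<close>.\<close>
        case 2
        then show ?thesis
          unfolding P up down using a by (auto simp: v l_up c_def abs_if split: if_splits)
      next
        case 3
        then show ?thesis
          unfolding P up down by (auto simp: v l_down c_def *)
      qed
    qed
    then show ?thesis
      by blast
  qed
  then show "quadrilateral (p, h\<^sub>1) (a, 0) (q, - h\<^sub>2) (- a, 0) = ?U"
    unfolding quadrilateral_def using inside_horizontal_strip[OF c l bdd] by simp
qed

section \<open>Monotonicity along the motion of the upper vertex\<close>

theorem proposition6p2: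
  fixes K :: "real \<Rightarrow> real" and a b\<^sub>1 b\<^sub>2 h\<^sub>1 h\<^sub>2 :: real
    and A :: "real \<Rightarrow> real \<times> real" and B C D :: "real \<times> real"
    and \<Omega> :: "real \<Rightarrow> (real \<times> real) set"
  assumes "K C1_differentiable_on {0<..}"
    and "strict_antimono_on {0<..} K"
    and "set_integrable lborel {0<..<1} (\<lambda>r. K r * r)"
    and "a > 0" "b\<^sub>1 > 0" "h\<^sub>1 > 0" "h\<^sub>2 > 0" "b\<^sub>2 \<ge> 0"
  defines "A \<equiv> \<lambda>t. (b\<^sub>1 * (t - 1), h\<^sub>1)"
    and "B \<equiv> (a, 0)"
    and "C \<equiv> (b\<^sub>2, - h\<^sub>2)"
    and "D \<equiv> (- a, 0)"
  defines "\<Omega> \<equiv> \<lambda>t. quadrilateral (A t) B C D"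
  shows "strict_mono_on {..1} (\<lambda>t. energy K (\<Omega> t))"
proof (rule strict_mono_onI)
  fix s t :: real
  assume "s \<in> {..1}" "t \<in> {..1}" "s < t"
  define c where "c t y = (if y \<ge> 0 then b\<^sub>1 * (t - 1) / h\<^sub>1 * y else - (b\<^sub>2 / h\<^sub>2) * y)" for t y
  define l where "l y = a * min (1 - y / h\<^sub>1) (1 + y / h\<^sub>2)" for y
  have cont: "continuous_on {0<..} K"
    using assms(1) by (rule C1_differentiable_imp_continuous_on)
  have anti: "antimono_on {0<..} K"
    using assms(2) by (auto simp: strict_antimono_iff_antimono)
  note quad = quadrilateral_eq_strip[OF \<open>a > 0\<close> \<open>h\<^sub>1 > 0\<close> \<open>h\<^sub>2 > 0\<close>, where q = b\<^sub>2]
  have \<Omega>: "\<Omega> t = {p. \<bar>fst p - c t (snd p)\<bar> < l (snd p)}" for t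
    unfolding \<Omega>_def A_def B_def C_def D_def c_def l_def by (rule quad(1))
  have int: "integrable lborel (interaction K {p. \<bar>fst p - c t (snd p)\<bar> < l (snd p)})" for t
    unfolding c_def l_def by (intro integrable_interaction[OF cont anti assms(3)] quad(2,3))
  \<comment> \<open>Here \<open>t \<le> 1\<close> enters: the upper part of the midline leans left,
    and less so for \<open>t\<close> than for \<open>s\<close>.\<close>
  have slope: "b\<^sub>1 * (s - 1) / h\<^sub>1 < b\<^sub>1 * (t - 1) / h\<^sub>1" "b\<^sub>1 * (t - 1) / h\<^sub>1 \<le> 0" "b\<^sub>2 / h\<^sub>2 \<ge> 0"
    using \<open>t \<in> {..1}\<close> \<open>s < t\<close> assms(4-8)
    by (auto simp: divide_strict_right_mono mult_nonneg_nonpos divide_nonpos_pos)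
  \<comment> \<open>For heights on the same side of the diagonal the midpoint distance is the
    absolute slope times \<open>\<bar>y - y'\<bar>\<close>. For heights on opposite sides,
    \<open>b\<^sub>2 \<ge> 0\<close> puts the lower midpoint weakly right of 0 and the upper one
    weakly left, so the two displacements add and the distance still grows with the upper slope
    \<open>m\<close>.\<close>
  have slices: "\<bar>c t y - c t y'\<bar> \<le> \<bar>c s y - c s y'\<bar>
      \<and> (0 < y' \<and> y' < y \<longrightarrow> \<bar>c t y - c t y'\<bar> < \<bar>c s y - c s y'\<bar>)" for y y'
  proof -
    define m m' n where "m = - (b\<^sub>1 * (t - 1) / h\<^sub>1)" "m' = - (b\<^sub>1 * (s - 1) / h\<^sub>1)" "n = b\<^sub>2 / h\<^sub>2"
    have mn: "0 \<le> m" "m < m'" "0 \<le> n"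
      using slope by (auto simp: m_m'_n_def)
    have ct: "c t y = (if y \<ge> 0 then - (m * y) else - (n * y))"
      and cs: "c s y = (if y \<ge> 0 then - (m' * y) else - (n * y))" for y
      by (auto simp: c_def m_m'_n_def)
    have same: "\<bar>- (k * y) - - (k * y')\<bar> = k * \<bar>y - y'\<bar>" if "k \<ge> 0" for k
      using that by (simp add: abs_mult_pos' abs_minus_commute flip: right_diff_distrib)
    have opposite: "\<bar>- (k * z) - - (n * z')\<bar> = k * z - n * z'" "\<bar>- (n * z') - - (k * z)\<bar> = k * z - n * z'"
      if "k \<ge> 0" "z \<ge> 0" "z' < 0" for k z z'
    proof -
      have "0 \<le> k * z" "n * z' \<le> 0"
        using that mn by (auto intro: mult_nonneg_nonpos)
      then show "\<bar>- (k * z) - - (n * z')\<bar> = k * z - n * z'" "\<bar>- (n * z') - - (k * z)\<bar> = k * z - n * z'"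
        by linarith+
    qed
    consider "y \<ge> 0" "y' \<ge> 0" | "y < 0" "y' < 0" | "y \<ge> 0" "y' < 0" | "y < 0" "y' \<ge> 0"
      by linarith
    then show ?thesis
    proof cases
      case 1
      then have "\<bar>c t y - c t y'\<bar> = m * \<bar>y - y'\<bar>" "\<bar>c s y - c s y'\<bar> = m' * \<bar>y - y'\<bar>"
        using same[of m] same[of m'] mn by (simp_all only: ct cs if_True)
      then show ?thesis
        using mn by (auto intro: mult_right_mono mult_strict_right_mono)
    next
      case 2
      then show ?thesis
        by (simp add: ct cs)
    next
      case 3
      then have "\<bar>c t y - c t y'\<bar> = m * y - n * y'" "\<bar>c s y - c s y'\<bar> = m' * y - n * y'"
        using opposite(1)[of m y y'] opposite(1)[of m' y y'] mn by (simp_all add: ct cs)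
      then show ?thesis
        using mn 3 by (auto intro: mult_right_mono)
    next
      case 4
      then have "\<bar>c t y - c t y'\<bar> = m * y' - n * y" "\<bar>c s y - c s y'\<bar> = m' * y' - n * y"
        using opposite(2)[of m y' y] opposite(2)[of m' y' y] mn by (simp_all add: ct cs)
      then show ?thesis
        using mn 4 by (auto intro: mult_right_mono)
    qed
  qed
  show "energy K (\<Omega> s) < energy K (\<Omega> t)"
    unfolding \<Omega>
  \<comment> \<open>\<open>G\<close> consists of pairs of distinct heights between the diagonal and
    the moving vertex, ordered so that it is open; there both slices have positive length and the
    midpoints get strictly closer.\<close>
  proof (rule energy_horizontal_strip_less[OF cont assms(2) int int, where G = "{p. 0 < snd p \<and> snd p < fst p \<and> fst p < h\<^sub>1}"])
    show "open {p :: real \<times> real. 0 < snd p \<and> snd p < fst p \<and> fst p < h\<^sub>1}"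
      by (intro open_Collect_conj open_Collect_less continuous_intros)
    have "(h\<^sub>1 / 2, h\<^sub>1 / 3) \<in> {p :: real \<times> real. 0 < snd p \<and> snd p < fst p \<and> fst p < h\<^sub>1}"
      using \<open>h\<^sub>1 > 0\<close> by simp
    then show "{p :: real \<times> real. 0 < snd p \<and> snd p < fst p \<and> fst p < h\<^sub>1} \<noteq> {}"
      by blast
    show "l y > 0 \<and> l y' > 0 \<and> \<bar>c t y - c t y'\<bar> < \<bar>c s y - c s y'\<bar>"
      if "(y, y') \<in> {p. 0 < snd p \<and> snd p < fst p \<and> fst p < h\<^sub>1}" for y y'
    proof -
      have "l z > 0" if "0 < z" "z < h\<^sub>1" for z
        using that assms(4-8) by (simp add: l_def add_pos_nonneg)
      then show ?thesis
        using that slices[of y y'] by auto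
    qed
  qed (use slices in blast)
qed

end
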